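(* Let $p\ge1$ and $r\ge1$ be integers. Then $$G^{(p)}_r(t,u,1,z)=\sum_{k=1}^\infty \frac{t^rz^ru^k\left(\delta_{k-1}^p-\delta_k^p\right)}{\gamma_1\cdots\gamma_k\,\delta_{k-1}^p\,\delta_k^p}.$$
   Context: For a finite integer sequence $(a_1,\dots,a_i)$, $\mathrm{asc}(a_1,\dots,a_i)=|\{j:1\le j<i,\ a_j<a_{j+1}\}|$. For an integer $p\ge1$, a $p$-ascent sequence of length $n\ge1$ is a sequence $(a_1,\dots,a_n)$ of nonnegative integers with $a_1=0$ and $a_i\le p+\mathrm{asc}(a_1,\dots,a_{i-1})$ for all $2\le i\le n$. For a sequence $w$, $|w|$ is its length, $\mathrm{asc}(w)$ its number of ascents, $\mathrm{last}(w)$ its last letter, and $|w|_0$ its number of zeros. For $r\ge1$, $G^{(p)}_r(t,u,v,z)=\sum_w t^{|w|}u^{\mathrm{asc}(w)}v^{\mathrm{last}(w)}z^{|w|_0}$, summed over all $p$-ascent sequences $w$ that begin with exactly $r$ zeros followed by a nonzero letter. Define $\delta_0=\gamma_0=1$ and, for $k\ge1$, $\delta_k=u-(1-t)^k(u-1)$ and $\gamma_k=u-(1-zt)(1-t)^{k-1}(u-1)$. The identity is one of formal power series. *)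

theory Defs
  imports "HOL-Computational_Algebra.Formal_Power_Series"
begin

definition asc :: "nat list \<Rightarrow> nat" where
  "asc w = card {j. Suc j < length w \<and> w ! j < w ! Suc j}"

text \<open>Lists are indexed from 0, so the \<open>i\<close>-th entry (from 0) is bounded through the ascents of the
  prefix consisting of the \<open>i\<close> entries before it.\<close>

definition p_ascent_seq :: "nat \<Rightarrow> nat list \<Rightarrow> bool" where
  "p_ascent_seq p w \<longleftrightarrow> w \<noteq> [] \<and> w ! 0 = 0 \<and>
     (\<forall>i. 1 \<le> i \<and> i < length w \<longrightarrow> w ! i \<le> p + asc (take i w))"

definition zeros :: "nat list \<Rightarrow> nat" where
  "zeros w = count_list w 0"

definition starts_with_exactly_zeros :: "nat \<Rightarrow> nat list \<Rightarrow> bool" where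
  "starts_with_exactly_zeros r w \<longleftrightarrow> r < length w \<and> (\<forall>i<r. w ! i = 0) \<and> w ! r \<noteq> 0"

text \<open>
  The ring of formal power series in \<open>u\<close>, \<open>t\<close>, \<open>z\<close> is rendered as iterated univariate series, with
  \<open>u\<close> the outermost and \<open>z\<close> the innermost variable. With this nesting the metric on the type
  is the \<open>u\<close>-adic one. This is the appropriate choice for the series below: its \<open>k\<close>-th term is
  divisible by \<open>u ^ k\<close>, but all terms have the same order in \<open>t\<close> and in \<open>z\<close>.
\<close>

type_synonym 'a series_utz = "'a fps fps fps"

definition U :: "rat series_utz" where "U = fps_X"
definition T :: "rat series_utz" where "T = fps_const fps_X"
definition Z :: "rat series_utz" where "Z = fps_const (fps_const fps_X)"

text \<open>
  The coefficient of \<open>u ^ a * t ^ n * z ^ m\<close> is the sum of \<open>v ^ last w\<close> over the finitely many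
  sequences \<open>w\<close> with \<open>a\<close> ascents, length \<open>n\<close> and \<open>m\<close> zeros (\<open>finite_ascent_seqs\<close> below). It is a polynomial
  in \<open>v\<close>, so \<open>v\<close> may be any element of a commutative semiring of coefficients: an indeterminate of
  a polynomial ring, or the number 1.
\<close>

definition ascent_seqs :: "nat \<Rightarrow> nat \<Rightarrow> nat \<Rightarrow> nat \<Rightarrow> nat \<Rightarrow> nat list set" where
  "ascent_seqs p r a n m =
     {w. p_ascent_seq p w \<and> starts_with_exactly_zeros r w \<and>
         asc w = a \<and> length w = n \<and> zeros w = m}"

definition G :: "nat \<Rightarrow> nat \<Rightarrow> 'a::comm_semiring_1 \<Rightarrow> 'a series_utz" where
  "G p r v = Abs_fps (\<lambda>a. Abs_fps (\<lambda>n. Abs_fps (\<lambda>m. \<Sum>w\<in>ascent_seqs p r a n m. v ^ last w)))"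

definition \<delta> :: "nat \<Rightarrow> rat series_utz" where
  "\<delta> k = (if k = 0 then 1 else U - (1 - T) ^ k * (U - 1))"

definition \<gamma> :: "nat \<Rightarrow> rat series_utz" where
  "\<gamma> k = (if k = 0 then 1 else U - (1 - Z * T) * (1 - T) ^ (k - 1) * (U - 1))"

lemma finite_ascent_seqs: "finite (ascent_seqs p r a n m)"
proof -
  have asc_le: "asc w \<le> length w" for w
  proof -
    have "card {j. Suc j < length w \<and> w ! j < w ! Suc j} \<le> card {..<length w}"
      by (rule card_mono) auto
    then show ?thesis by (simp add: asc_def)
  qed
  have "ascent_seqs p r a n m \<subseteq> {w. set w \<subseteq> {..p + n} \<and> length w = n}"
  proof (clarsimp simp: ascent_seqs_def p_ascent_seq_def in_set_conv_nth)
    fix w :: "nat list" and i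
    assume b: "\<forall>i. Suc 0 \<le> i \<and> i < length w \<longrightarrow> w ! i \<le> p + asc (take i w)"
      and z: "w ! 0 = 0" and i: "i < length w"
    show "w ! i \<le> p + length w"
    proof (cases "i = 0")
      case False
      then have "w ! i \<le> p + asc (take i w)" using b i by simp
      also have "\<dots> \<le> p + length w" using asc_le[of "take i w"] i by simp
      finally show ?thesis .
    qed (simp add: z)
  qed
  then show ?thesis
    by (rule finite_subset) (simp add: finite_lists_length_eq)
qed

text \<open>
  The following lemma confirms that the denominators of the identity are units, so
  that division has its usual meaning.
\<close>

lemma divide_denominator_cancel:
  fixes x :: "rat series_utz"
  shows "x / ((\<Prod>i=1..k. \<gamma> i) * \<delta> (k - 1) ^ p * \<delta> k ^ p) * ((\<Prod>i=1..k. \<gamma> i) * \<delta> (k - 1) ^ p * \<delta> k ^ p) = x"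
proof -
  define c :: "rat series_utz \<Rightarrow> rat fps" where "c f = fps_nth (fps_nth f 0) 0" for f
  have c_mult: "c (f * g) = c f * c g" for f g by (simp add: c_def)
  have c_one: "c 1 = 1" by (simp add: c_def)
  have c_pow: "c (f ^ n) = c f ^ n" for f n by (induction n) (simp_all add: c_mult c_one)
  have c_minus: "c (f - g) = c f - c g" for f g by (simp add: c_def)
  have cU: "c U = 0" and cT: "c T = 0" by (simp_all add: c_def U_def T_def)
  have c_delta: "c (\<delta> i) = 1" for i
    by (simp add: \<delta>_def c_mult c_pow c_minus c_one cU cT)
  have c_gamma: "c (\<gamma> i) = 1" for i
    by (simp add: \<gamma>_def c_mult c_pow c_minus c_one cU cT)
  have c_prod: "c (\<Prod>i\<in>A. \<gamma> i) = 1" if "finite A" for A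
    using that by induction (simp_all add: c_mult c_one c_gamma)
  define D where "D = (\<Prod>i=1..k. \<gamma> i) * \<delta> (k - 1) ^ p * \<delta> k ^ p"
  have "c D = 1" by (simp add: D_def c_mult c_pow c_delta c_prod)
  then have D00: "fps_nth (fps_nth D 0) 0 = 1" by (simp add: c_def)
  then have D0: "fps_nth D 0 \<noteq> 0" by auto
  have "fps_nth D 0 * inverse (fps_nth D 0) = 1"
    unfolding fps_inverse_def[of "fps_nth D 0"] by (rule fps_right_inverse) (simp add: D00)
  then have "D * inverse D = 1"
    unfolding fps_inverse_def[of D] by (rule fps_right_inverse)
  moreover have "x / D = x * inverse D"
    using D0 by (simp add: fps_divide_unit)
  ultimately have "x / D * D = x"
    by (simp add: mult.assoc mult.commute[of "inverse D"])
  then show ?thesis by (simp add: D_def)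
qed

end

theory Submission
  imports Defs
begin

text \<open>
  Removing the last letter of a sequence gives a linear equation for the generating function
  \<open>G(u, v)\<close> in which \<open>G(u, v)\<close> has the coefficient \<open>v - 1 - t v + t u v\<close>, and the other unknowns are
  \<open>G(u, 1)\<close> and \<open>G(u v, 1)\<close>. The kernel vanishes at \<open>v = 1 / \<delta>\<^sub>1\<close>, which leaves
  \<open>\<gamma>\<^sub>1 G(u, 1) = u t\<^sup>r z\<^sup>r (v\<^sup>p - 1) + u v\<^sup>p G(u v, 1)\<close>. The substitution \<open>u \<mapsto> u / \<delta>\<^sub>1\<close> maps
  \<open>\<delta>\<^sub>k\<close> to \<open>\<delta>\<^sub>k\<^sub>+\<^sub>1 / \<delta>\<^sub>1\<close> and \<open>\<gamma>\<^sub>k\<close> to \<open>\<gamma>\<^sub>k\<^sub>+\<^sub>1 / \<delta>\<^sub>1\<close>. Hence each iteration of the equation splits off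
  the next term of the series, and the remainder after \<open>n\<close> iterations is divisible by \<open>u ^ n\<close>.
\<close>

subsection \<open>Appending a letter to an ascent sequence\<close>

lemma asc_snoc:
  assumes "w \<noteq> []"
  shows "asc (w @ [x]) = asc w + (if last w < x then 1 else 0)"
proof -
  let ?A = "{j. Suc j < length w \<and> w ! j < w ! Suc j}"
  let ?l = "length w - 1"
  have fin: "finite ?A" by (rule finite_subset[of _ "{..<length w}"]) auto
  have "{j. Suc j < length (w @ [x]) \<and> (w @ [x]) ! j < (w @ [x]) ! Suc j}
      = ?A \<union> (if last w < x then {?l} else {})"
    (is "?L = ?R")
  proof (rule set_eqI)
    fix j
    consider "Suc j < length w" | "Suc j = length w" | "Suc j > length w" by linarith
    then show "j \<in> ?L \<longleftrightarrow> j \<in> ?R"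
    proof cases
      case 2
      then have "j = ?l" by simp
      with 2 assms show ?thesis by (auto simp: nth_append last_conv_nth)
    qed (use assms in \<open>auto simp: nth_append split: if_splits\<close>)
  qed
  moreover have "?l \<notin> ?A" using assms by simp
  ultimately show ?thesis using fin by (simp add: asc_def)
qed

lemma asc_replicate [simp]: "asc (replicate n x) = 0"
proof -
  have "{j. Suc j < n \<and> replicate n x ! j < replicate n x ! Suc j} = {}" by auto
  then show ?thesis unfolding asc_def length_replicate by (simp only: card.empty)
qed

lemma zeros_snoc: "zeros (w @ [x]) = zeros w + (if x = 0 then 1 else 0)"
  by (simp add: zeros_def)

lemma zeros_replicate: "zeros (replicate n 0) = n"
  by (induction n) (simp_all add: zeros_def)

lemma p_ascent_seq_snoc:
  assumes "w \<noteq> []"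
  shows "p_ascent_seq p (w @ [x]) \<longleftrightarrow> p_ascent_seq p w \<and> x \<le> p + asc w"
proof -
  have "(\<forall>i. 1 \<le> i \<and> i < length (w @ [x]) \<longrightarrow> (w @ [x]) ! i \<le> p + asc (take i (w @ [x])))
      \<longleftrightarrow> (\<forall>i. 1 \<le> i \<and> i < length w \<longrightarrow> w ! i \<le> p + asc (take i w)) \<and> x \<le> p + asc w"
    (is "?L \<longleftrightarrow> ?R")
  proof
    assume L: ?L
    have "w ! i \<le> p + asc (take i w)" if "1 \<le> i \<and> i < length w" for i
      using L[rule_format, of i] that by (simp add: nth_append)
    moreover have "x \<le> p + asc w"
      using L[rule_format, of "length w"] assms by (simp add: Suc_le_eq)
    ultimately show ?R by blast
  next
    assume ?R
    then show ?L by (auto simp: nth_append less_Suc_eq)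
  qed
  then show ?thesis using assms by (simp add: p_ascent_seq_def nth_append)
qed

lemma starts_with_exactly_zeros_snoc:
  "starts_with_exactly_zeros r (w @ [x]) \<longleftrightarrow>
     starts_with_exactly_zeros r w \<or> w = replicate r 0 \<and> x \<noteq> 0"
proof -
  consider "r < length w" | "r = length w" | "r > length w" by linarith
  then show ?thesis
  proof cases
    case 2
    then show ?thesis
      by (auto simp: starts_with_exactly_zeros_def nth_append list_eq_iff_nth_eq)
  qed (auto simp: starts_with_exactly_zeros_def nth_append)
qed

lemma p_ascent_seq_replicate: "r \<ge> 1 \<Longrightarrow> p_ascent_seq p (replicate r 0)"
  by (simp add: p_ascent_seq_def)

text \<open>Confines the last letter to \<open>{..p + a}\<close>, so that every sum over last
  letters is finite.\<close>

lemma last_le_if_p_ascent_seq: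
  assumes "p_ascent_seq p w"
  shows "last w \<le> p + asc w"
proof (cases w rule: rev_cases)
  case Nil
  with assms show ?thesis by (simp add: p_ascent_seq_def)
next
  case (snoc v x)
  show ?thesis
  proof (cases "v = []")
    case True
    with snoc assms show ?thesis by (simp add: p_ascent_seq_def)
  next
    case False
    with snoc assms show ?thesis by (simp add: p_ascent_seq_snoc asc_snoc)
  qed
qed

section \<open>Counting by the last letter\<close>

definition ascent_seqs_last :: "nat \<Rightarrow> nat \<Rightarrow> nat \<Rightarrow> nat \<Rightarrow> nat \<Rightarrow> nat \<Rightarrow> nat list set" where
  "ascent_seqs_last p r a n m l = {w \<in> ascent_seqs p r a n m. last w = l}"

lemma finite_ascent_seqs_last [simp]: "finite (ascent_seqs_last p r a n m l)"
  by (simp add: ascent_seqs_last_def finite_ascent_seqs)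

lemma ascent_seqs_last_0: "ascent_seqs_last p r a 0 m l = {}"
  by (auto simp: ascent_seqs_last_def ascent_seqs_def p_ascent_seq_def)

lemma ascent_seqs_last_0_no_zeros: "ascent_seqs_last p r a n 0 0 = {}"
proof -
  have "zeros w \<noteq> 0" if "p_ascent_seq p w" for w
    using that by (cases w) (auto simp: p_ascent_seq_def zeros_def)
  then show ?thesis by (auto simp: ascent_seqs_last_def ascent_seqs_def)
qed

lemma ascent_seqs_eq_UN:
  "ascent_seqs p r a n m = (\<Union>l\<le>p + a. ascent_seqs_last p r a n m l)"
  using last_le_if_p_ascent_seq by (auto simp: ascent_seqs_last_def ascent_seqs_def)

lemma card_UN_ascent_seqs_last:
  assumes "finite L"
  shows "card (\<Union>l\<in>L. ascent_seqs_last p r a n m l)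
    = (\<Sum>l\<in>L. card (ascent_seqs_last p r a n m l))"
proof (rule card_UN_disjoint)
  show "\<forall>l\<in>L. \<forall>l'\<in>L. l \<noteq> l' \<longrightarrow>
      ascent_seqs_last p r a n m l \<inter> ascent_seqs_last p r a n m l' = {}"
    by (auto simp: ascent_seqs_last_def)
qed (use assms in auto)

lemma card_ascent_seqs:
  "card (ascent_seqs p r a n m) = (\<Sum>l\<le>p + a. card (ascent_seqs_last p r a n m l))"
  by (simp add: ascent_seqs_eq_UN card_UN_ascent_seqs_last)

text \<open>Delete the last letter \<open>i\<close>. What remains is the all-zero word
  (\<open>B\<close>), which is not itself counted, or a counted word whose last letter is at least
  \<open>i\<close> (\<open>C\<close>, no new ascent) or below \<open>i\<close> (\<open>D\<close>,
  one ascent fewer). The shift from \<open>m\<close> to \<open>m'\<close> accounts for a deleted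
  zero.\<close>

lemma card_ascent_seqs_last_Suc:
  fixes i m :: nat
  assumes r: "r \<ge> 1"
  defines "m' \<equiv> m + (if i = 0 then 1 else 0)"
  shows "card (ascent_seqs_last p r a (Suc n) m' i) =
     (if a = 1 \<and> n = r \<and> m = r \<and> i \<in> {1..p} then 1 else 0)
   + (\<Sum>l\<in>{i..p + a}. card (ascent_seqs_last p r a n m l))
   + (if a \<ge> 1 \<and> i \<le> p + (a - 1) then \<Sum>l<i. card (ascent_seqs_last p r (a - 1) n m l) else 0)"
proof -
  define B where "B = (if a = 1 \<and> n = r \<and> m = r \<and> i \<in> {1..p} then {replicate r (0::nat)} else {})"
  define C where "C = (\<Union>l\<in>{i..p + a}. ascent_seqs_last p r a n m l)"
  define D where "D = (\<Union>l\<in>(if a \<ge> 1 \<and> i \<le> p + (a - 1) then {..<i} else {}).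
    ascent_seqs_last p r (a - 1) n m l)"
  have snoc_iff: "w @ [i] \<in> ascent_seqs_last p r a (Suc n) m' i \<longleftrightarrow> w \<in> B \<union> (C \<union> D)" for w
  proof (cases "w = []")
    case True
    then show ?thesis using r
      by (auto simp: B_def C_def D_def ascent_seqs_last_def ascent_seqs_def p_ascent_seq_def
          starts_with_exactly_zeros_def split: if_splits)
  next
    case ne: False
    have mem: "w @ [i] \<in> ascent_seqs_last p r a (Suc n) m' i \<longleftrightarrow>
      p_ascent_seq p w \<and> i \<le> p + asc w \<and>
      (starts_with_exactly_zeros r w \<or> w = replicate r 0 \<and> i \<noteq> 0) \<and>
      asc w + (if last w < i then 1 else 0) = a \<and> length w = n \<and> zeros w = m"
      using ne by (auto simp: ascent_seqs_last_def ascent_seqs_def p_ascent_seq_snoc asc_snoc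
          zeros_snoc starts_with_exactly_zeros_snoc m'_def)
    \<comment> \<open>In \<open>C\<close> the bound on \<open>i\<close> is automatic, since
      \<open>i \<le> last w \<le> p + asc w\<close>; in \<open>D\<close> it has to be
      imposed.\<close>
    have CD: "w \<in> C \<union> D \<longleftrightarrow> p_ascent_seq p w \<and> i \<le> p + asc w \<and> starts_with_exactly_zeros r w \<and>
      asc w + (if last w < i then 1 else 0) = a \<and> length w = n \<and> zeros w = m"
      using last_le_if_p_ascent_seq[of p w]
      by (auto simp: C_def D_def ascent_seqs_last_def ascent_seqs_def not_less split: if_splits)
    show ?thesis
    proof (cases "w = replicate r 0")
      case True
      then have "\<not> starts_with_exactly_zeros r w"
        by (simp add: starts_with_exactly_zeros_def)
      with mem CD True r show ?thesis
        by (auto simp: B_def p_ascent_seq_replicate zeros_replicate split: if_splits)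
    next
      case False
      with mem CD show ?thesis by (auto simp: B_def)
    qed
  qed
  have "ascent_seqs_last p r a (Suc n) m' i = (\<lambda>w. w @ [i]) ` (B \<union> (C \<union> D))"
  proof (rule set_eqI)
    fix w
    show "w \<in> ascent_seqs_last p r a (Suc n) m' i \<longleftrightarrow> w \<in> (\<lambda>w. w @ [i]) ` (B \<union> (C \<union> D))"
    proof (cases w rule: rev_cases)
      case Nil
      then show ?thesis
        by (auto simp: ascent_seqs_last_def ascent_seqs_def)
    next
      case (snoc v x)
      show ?thesis
      proof (cases "x = i")
        case True
        show ?thesis unfolding snoc True using snoc_iff[of v] by auto
      next
        case False
        then show ?thesis unfolding snoc by (auto simp: ascent_seqs_last_def)
      qed
    qed
  qed
  then have "card (ascent_seqs_last p r a (Suc n) m' i) = card (B \<union> (C \<union> D))"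
    by (simp add: card_image inj_on_def)
  also have "\<dots> = card B + card (C \<union> D)"
  proof (rule card_Un_disjoint)
    have "\<not> starts_with_exactly_zeros r (replicate r 0)"
      by (simp add: starts_with_exactly_zeros_def)
    then show "B \<inter> (C \<union> D) = {}"
      by (auto simp: B_def C_def D_def ascent_seqs_last_def ascent_seqs_def)
  qed (auto simp: B_def C_def D_def)
  also have "card (C \<union> D) = card C + card D"
  proof (rule card_Un_disjoint)
    show "C \<inter> D = {}"
      by (auto simp: C_def D_def ascent_seqs_last_def ascent_seqs_def)
  qed (auto simp: C_def D_def)
  also have "card B = (if a = 1 \<and> n = r \<and> m = r \<and> i \<in> {1..p} then 1 else 0)"
    by (simp add: B_def)
  also have "card C = (\<Sum>l\<in>{i..p + a}. card (ascent_seqs_last p r a n m l))"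
    by (simp add: C_def card_UN_ascent_seqs_last)
  also have "card D = (if a \<ge> 1 \<and> i \<le> p + (a - 1)
      then \<Sum>l<i. card (ascent_seqs_last p r (a - 1) n m l) else 0)"
    unfolding D_def by (subst card_UN_ascent_seqs_last) auto
  finally show ?thesis by (simp only: add.assoc)
qed

subsection \<open>Sums of series weighted by powers of the variable\<close>

lemma fps_const_sum: "fps_const (\<Sum>i\<in>A. f i) = (\<Sum>i\<in>A. fps_const (f i))"
  by (rule fps_ext) (simp add: fps_sum_nth)

text \<open>The series \<open>\<Sum>a. f a * X ^ a\<close>, where the coefficients \<open>f a\<close> may themselves involve \<open>X\<close>.\<close>

definition fps_layered :: "(nat \<Rightarrow> 'a::comm_ring_1 fps) \<Rightarrow> 'a fps" where
  "fps_layered f = Abs_fps (\<lambda>n. \<Sum>a\<le>n. fps_nth (f a) (n - a))"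

lemma fps_layered_add: "fps_layered (\<lambda>a. f a + g a) = fps_layered f + fps_layered g"
  by (rule fps_ext) (simp add: fps_layered_def sum.distrib)

lemma fps_layered_diff: "fps_layered (\<lambda>a. f a - g a) = fps_layered f - fps_layered g"
  by (rule fps_ext) (simp add: fps_layered_def sum_subtractf)

text \<open>Each coefficient depends on finitely many layers only, which reduces identities to
  finite sums.\<close>

lemma fps_layered_nth:
  assumes "n \<le> N"
  shows "fps_nth (fps_layered f) n = fps_nth (\<Sum>a\<le>N. f a * fps_X ^ a) n"
proof -
  have "(\<Sum>a\<le>N. if n < a then 0 else fps_nth (f a) (n - a)) = (\<Sum>a\<le>n. fps_nth (f a) (n - a))"
    by (rule sum.mono_neutral_cong_right) (use assms in auto)
  then show ?thesis
    by (simp add: fps_layered_def fps_sum_nth fps_X_power_mult_right_nth)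
qed

lemma fps_layered_mult_left: "fps_layered (\<lambda>a. c * f a) = c * fps_layered f"
proof (rule fps_ext)
  fix n
  have "fps_nth (c * fps_layered f) n = fps_nth (c * (\<Sum>a\<le>n. f a * fps_X ^ a)) n"
    by (simp add: fps_mult_nth fps_layered_nth[of _ n])
  also have "\<dots> = fps_nth (fps_layered (\<lambda>a. c * f a)) n"
    by (simp add: fps_layered_nth[of n n] sum_distrib_left mult.assoc)
  finally show "fps_nth (fps_layered (\<lambda>a. c * f a)) n = fps_nth (c * fps_layered f) n" ..
qed

lemma fps_layered_shift:
  "fps_layered (case_nat 0 f) = fps_X * fps_layered f"
proof (rule fps_ext)
  fix n
  show "fps_nth (fps_layered (case_nat 0 f)) n = fps_nth (fps_X * fps_layered f) n"
    by (cases n) (simp_all add: fps_layered_def sum.atMost_Suc_shift del: sum.atMost_Suc)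
qed

lemma fps_layered_const: "fps_layered (\<lambda>a. fps_const (fps_nth F a)) = F"
proof (rule fps_ext)
  fix n
  have "(\<Sum>a\<le>n. fps_nth (fps_const (fps_nth F a)) (n - a)) = (\<Sum>a\<in>{n}. fps_nth F a)"
    by (rule sum.mono_neutral_cong_right) auto
  then show "fps_nth (fps_layered (\<lambda>a. fps_const (fps_nth F a))) n = fps_nth F n"
    by (simp add: fps_layered_def)
qed

text \<open>This is how G(uv, 1) arises: an extra \<open>v ^ a\<close> on layer \<open>a\<close>
  amounts to substituting uv for u.\<close>

lemma fps_layered_compose:
  "fps_layered (\<lambda>a. fps_const (fps_nth F a) * v ^ a) = F oo (fps_X * v)"
  by (rule fps_ext)
    (simp add: fps_layered_def fps_compose_nth power_mult_distrib fps_X_power_mult_nth atMost_atLeast0)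

subsection \<open>The kernel method\<close>

definition last_gf :: "nat \<Rightarrow> nat \<Rightarrow> nat \<Rightarrow> nat \<Rightarrow> rat fps fps" where
  "last_gf p r a l = Abs_fps (\<lambda>n. Abs_fps (\<lambda>m. of_nat (card (ascent_seqs_last p r a n m l))))"

text \<open>
  The part of the generating function with \<open>a\<close> ascents, without the factor \<open>u ^ a\<close>. The variable \<open>v\<close>
  that marks the last letter ranges over all series, because the kernel method substitutes a series
  in \<open>u\<close> and \<open>t\<close> for it.
\<close>

definition layer :: "nat \<Rightarrow> nat \<Rightarrow> nat \<Rightarrow> rat series_utz \<Rightarrow> rat series_utz" where
  "layer p r a v = (\<Sum>l\<le>p + a. fps_const (last_gf p r a l) * v ^ l)"

lemma layer_1: "layer p r a 1 = fps_const (fps_nth (G p r 1) a)"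
proof -
  have "fps_nth (G p r 1) a = (\<Sum>l\<le>p + a. last_gf p r a l)"
    by (intro fps_ext) (simp add: G_def last_gf_def fps_sum_nth card_ascent_seqs)
  then show ?thesis by (simp add: layer_def fps_const_sum)
qed

text \<open>The outer variable marks length, the inner one zeros. The base term stands for r zeros
  followed by \<open>i\<close>: r + 1 letters, r zeros, one ascent.\<close>

lemma last_gf_rec:
  assumes r: "r \<ge> 1"
  shows "last_gf p r a i =
      (if a = 1 \<and> i \<in> {1..p} then fps_X ^ Suc r * fps_const (fps_X ^ r) else 0)
    + fps_X * (if i = 0 then fps_const fps_X else 1) *
      ((\<Sum>l\<in>{i..p + a}. last_gf p r a l)
       + (if a \<ge> 1 \<and> i \<le> p + (a - 1) then \<Sum>l<i. last_gf p r (a - 1) l else 0))"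
    (is "?L = ?R")
proof (intro fps_ext)
  fix n m
  show "fps_nth (fps_nth ?L n) m = fps_nth (fps_nth ?R n) m"
  proof (cases n)
    case 0
    then show ?thesis by (simp add: last_gf_def ascent_seqs_last_0 mult.assoc)
  next
    case (Suc n')
    have base: "fps_nth (fps_nth (fps_X ^ Suc r * fps_const (fps_X ^ r)) (Suc n')) m
        = (if n' = r \<and> m = r then 1 else 0 :: rat)" for n' m
      by (simp add: fps_X_power_iff)
    show ?thesis
    proof (cases "i = 0")
      case False
      then show ?thesis
        using card_ascent_seqs_last_Suc[OF r, of p a n' m i]
        by (auto simp: Suc last_gf_def fps_sum_nth base mult.assoc simp del: power_Suc)
    next
      case True
      show ?thesis
      proof (cases m)
        case 0
        then show ?thesis
          by (simp add: Suc True last_gf_def ascent_seqs_last_0_no_zeros mult.assoc)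
      next
        case m: (Suc m')
        show ?thesis
          using card_ascent_seqs_last_Suc[OF r, of p a n' m' i] True
          by (auto simp: Suc m last_gf_def fps_sum_nth mult.assoc)
      qed
    qed
  qed
qed

text \<open>A geometric sum, kept free of division by the factor \<open>v - 1\<close>; the weight
  \<open>z\<close> at \<open>i = 0\<close> causes the correction term.\<close>

lemma sum_upto_weight_0:
  fixes v z :: "'a::comm_ring_1"
  shows "(v - 1) * (\<Sum>i\<le>l. (if i = 0 then z else 1) * v ^ i) = v ^ Suc l - 1 + (z - 1) * (v - 1)"
  by (induction l) (simp_all add: algebra_simps)

lemma sum_greaterThanAtMost_power:
  fixes v :: "'a::comm_ring_1"
  assumes "l \<le> N"
  shows "(v - 1) * (\<Sum>i\<in>{l<..N}. v ^ i) = v ^ Suc N - v ^ Suc l"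
  using assms
proof (induction N rule: dec_induct)
  case (step N)
  then have "{l<..Suc N} = insert (Suc N) {l<..N}" by auto
  with step show ?case by (simp add: algebra_simps)
qed simp

text \<open>Multiply the recurrence for \<open>last_gf\<close> by \<open>v ^ i\<close>, sum over the
  new letter \<open>i\<close>, and exchange this with the sum over the old last letter
  \<open>l\<close>. The inner sums over \<open>i\<close> become geometric: \<open>i \<le> l\<close>
  without a new ascent, \<open>l < i \<le> p + b\<close> with one. The upper limit
  \<open>p + b\<close> produces the factor \<open>v ^ b\<close>.\<close>

lemma layer_rec:
  assumes r: "r \<ge> 1"
  shows "(v - 1) * layer p r a v =
     (if a = 1 then T ^ Suc r * Z ^ r * (v ^ Suc p - v) else 0)
   + T * (v * layer p r a v - layer p r a 1 + (Z - 1) * (v - 1) * layer p r a 1)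
   + T * (case a of 0 \<Rightarrow> 0
          | Suc b \<Rightarrow> v ^ Suc p * (layer p r b 1 * v ^ b) - v * layer p r b v)"
proof -
  let ?c = "\<lambda>a l. fps_const (last_gf p r a l)"
  let ?z = "\<lambda>i. if i = 0 then Z else 1 :: rat series_utz"
  let ?b = "\<lambda>i. if a = 1 \<and> i \<in> {1..p} then T ^ Suc r * Z ^ r else 0"
  let ?S = "\<lambda>i. \<Sum>l\<in>{i..p + a}. ?c a l"
  let ?D = "\<lambda>i. if a \<ge> 1 \<and> i \<le> p + (a - 1) then \<Sum>l<i. ?c (a - 1) l else 0"
  have c: "?c a i = ?b i + T * ?z i * (?S i + ?D i)" for i
    by (subst last_gf_rec[OF r])
      (auto simp: T_def Z_def simp flip: fps_const_mult fps_const_add fps_const_power fps_const_sum)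
  have "layer p r a v = (\<Sum>i\<le>p + a. ?c a i * v ^ i)"
    by (simp add: layer_def)
  also have "\<dots> = (\<Sum>i\<le>p + a. ?b i * v ^ i) + T * (\<Sum>i\<le>p + a. ?z i * v ^ i * ?S i)
      + T * (\<Sum>i\<le>p + a. ?z i * v ^ i * ?D i)"
    by (subst c) (simp add: algebra_simps sum.distrib sum_distrib_left)
  finally have L: "(v - 1) * layer p r a v = (v - 1) * (\<Sum>i\<le>p + a. ?b i * v ^ i)
      + T * ((v - 1) * (\<Sum>i\<le>p + a. ?z i * v ^ i * ?S i))
      + T * ((v - 1) * (\<Sum>i\<le>p + a. ?z i * v ^ i * ?D i))"
    by (simp add: algebra_simps)
  have 1: "(v - 1) * (\<Sum>i\<le>p + a. ?b i * v ^ i)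
      = (if a = 1 then T ^ Suc r * Z ^ r * (v ^ Suc p - v) else 0)"
  proof (cases "a = 1")
    case True
    have "(\<Sum>i\<le>p + a. ?b i * v ^ i) = (\<Sum>i\<in>{0<..p}. T ^ Suc r * Z ^ r * v ^ i)"
      by (rule sum.mono_neutral_cong_right) (use True in auto)
    then have "(v - 1) * (\<Sum>i\<le>p + a. ?b i * v ^ i)
        = T ^ Suc r * Z ^ r * ((v - 1) * (\<Sum>i\<in>{0<..p}. v ^ i))"
      by (simp add: sum_distrib_left mult_ac)
    then show ?thesis using True by (simp add: sum_greaterThanAtMost_power)
  qed simp
  have "(\<Sum>i\<le>p + a. ?z i * v ^ i * ?S i)
      = (\<Sum>i\<in>{..p + a}. \<Sum>l | l \<in> {..p + a} \<and> i \<le> l. ?z i * v ^ i * ?c a l)"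
    by (auto simp: sum_distrib_left intro!: sum.cong)
  also have "\<dots> = (\<Sum>l\<in>{..p + a}. \<Sum>i | i \<in> {..p + a} \<and> i \<le> l. ?z i * v ^ i * ?c a l)"
    by (rule sum.swap_restrict) auto
  also have "\<dots> = (\<Sum>l\<le>p + a. ?c a l * (\<Sum>i\<le>l. ?z i * v ^ i))"
    unfolding sum_distrib_left by (intro sum.cong) auto
  finally have "(v - 1) * (\<Sum>i\<le>p + a. ?z i * v ^ i * ?S i)
      = (\<Sum>l\<le>p + a. ?c a l * ((v - 1) * (\<Sum>i\<le>l. ?z i * v ^ i)))"
    by (simp add: sum_distrib_left mult_ac)
  also have "\<dots> = v * layer p r a v - layer p r a 1 + (Z - 1) * (v - 1) * layer p r a 1"
    unfolding sum_upto_weight_0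
    by (simp add: layer_def sum_distrib_left sum_subtractf sum.distrib algebra_simps)
  finally have 2: "(v - 1) * (\<Sum>i\<le>p + a. ?z i * v ^ i * ?S i) = \<dots>" .
  have 3: "(v - 1) * (\<Sum>i\<le>p + a. ?z i * v ^ i * ?D i) = (case a of 0 \<Rightarrow> 0
          | Suc b \<Rightarrow> v ^ Suc p * (layer p r b 1 * v ^ b) - v * layer p r b v)"
  proof (cases a)
    case (Suc b)
    have "(\<Sum>i\<le>p + a. ?z i * v ^ i * ?D i)
        = (\<Sum>i\<in>{..p + b}. \<Sum>l | l \<in> {..p + b} \<and> l < i. v ^ i * ?c b l)"
    \<comment> \<open>The index \<open>p + a\<close> violates the bound for \<open>a - 1\<close>
      ascents. The weight \<open>Z\<close> disappears because at \<open>i = 0\<close> there is no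
      \<open>l < i\<close>.\<close>
    proof (rule sum.mono_neutral_cong_right)
      fix i assume "i \<in> {..p + b}"
      then have "{l. l \<in> {..p + b} \<and> l < i} = {..<i}" by auto
      then show "?z i * v ^ i * ?D i = (\<Sum>l | l \<in> {..p + b} \<and> l < i. v ^ i * ?c b l)"
        using \<open>i \<in> {..p + b}\<close> Suc by (simp add: sum_distrib_left)
    qed (use Suc in auto)
    also have "\<dots> = (\<Sum>l\<in>{..p + b}. \<Sum>i | i \<in> {..p + b} \<and> l < i. v ^ i * ?c b l)"
      by (rule sum.swap_restrict) auto
    also have "\<dots> = (\<Sum>l\<le>p + b. ?c b l * (\<Sum>i\<in>{l<..p + b}. v ^ i))"
      unfolding sum_distrib_left by (intro sum.cong) auto
    finally have "(v - 1) * (\<Sum>i\<le>p + a. ?z i * v ^ i * ?D i)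
        = (\<Sum>l\<le>p + b. ?c b l * ((v - 1) * (\<Sum>i\<in>{l<..p + b}. v ^ i)))"
      by (simp add: sum_distrib_left mult_ac)
    also have "\<dots> = (\<Sum>l\<le>p + b. ?c b l * (v ^ Suc (p + b) - v ^ Suc l))"
      by (intro sum.cong) (simp_all add: sum_greaterThanAtMost_power)
    also have "\<dots> = v ^ Suc p * (layer p r b 1 * v ^ b) - v * layer p r b v"
      by (simp add: layer_def sum_distrib_left sum_distrib_right sum_subtractf algebra_simps power_add)
    finally show ?thesis using Suc by simp
  qed simp
  show ?thesis unfolding L 1 2 3 by (simp add: algebra_simps)
qed

text \<open>Sum \<open>layer_rec\<close> over all \<open>a\<close> with weight \<open>U ^ a\<close>;
  the shift from \<open>b\<close> to \<open>Suc b\<close> contributes the factor \<open>U\<close> of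
  the last term.\<close>

lemma kernel_equation:
  fixes p r :: nat and v :: "rat series_utz"
  assumes r: "r \<ge> 1"
  defines "g \<equiv> G p r 1"
  defines "h \<equiv> fps_layered (\<lambda>a. layer p r a v)"
  shows "(v - 1) * h = U * T ^ Suc r * Z ^ r * (v ^ Suc p - v)
      + T * (v * h - g + (Z - 1) * (v - 1) * g)
      + T * U * (v ^ Suc p * (g oo (U * v)) - v * h)"
proof -
  have g: "fps_layered (\<lambda>a. layer p r a 1) = g"
    by (simp add: layer_1 g_def fps_layered_const)
  have gv: "fps_layered (\<lambda>a. layer p r a 1 * v ^ a) = g oo (U * v)"
    by (simp add: layer_1 g_def fps_layered_compose U_def)
  have base: "fps_layered (\<lambda>a. if a = 1 then c else 0) = U * c" for c :: "rat series_utz"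
  proof -
    have "fps_layered (\<lambda>a. if a = 1 then c else 0) = fps_layered (case_nat 0 (case_nat c (\<lambda>_. 0)))"
      by (rule arg_cong[of _ _ fps_layered]) (auto split: nat.split)
    also have "\<dots> = U * fps_layered (case_nat c (\<lambda>_. 0))"
      by (simp add: fps_layered_shift U_def)
    also have "fps_layered (case_nat c (\<lambda>_. 0)) = c"
    proof (rule fps_ext)
      fix n
      show "fps_nth (fps_layered (case_nat c (\<lambda>_. 0))) n = fps_nth c n"
        by (cases n) (simp_all add: fps_layered_def sum.atMost_Suc_shift del: sum.atMost_Suc)
    qed
    finally show ?thesis .
  qed
  have "(v - 1) * h = fps_layered (\<lambda>a. (v - 1) * layer p r a v)"
    by (simp add: h_def fps_layered_mult_left)
  also have "\<dots> = U * (T ^ Suc r * Z ^ r * (v ^ Suc p - v))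
      + T * (v * h - g + (Z - 1) * (v - 1) * g)
      + T * (U * (v ^ Suc p * (g oo (U * v)) - v * h))"
    unfolding layer_rec[OF r] fps_layered_add fps_layered_diff fps_layered_mult_left base g
      fps_layered_shift gv h_def[symmetric]
    by (simp add: U_def)
  finally show ?thesis by (simp add: mult_ac)
qed

section \<open>The substitution of uv for u at the root of the kernel\<close>

lemma \<delta>_altdef: "\<delta> k = U - (1 - T) ^ k * (U - 1)"
  by (simp add: \<delta>_def)

lemma U_T_Z_compose [simp]:
  "T oo c = T" "Z oo c = Z" "fps_nth c 0 = 0 \<Longrightarrow> U oo c = c"
  by (simp_all add: U_def T_def Z_def)

lemma U_nth_0: "fps_nth U 0 = 0"
  by (simp add: U_def)

text \<open>With v = 1 / \<open>\<delta> 1\<close>, the substitution sends \<open>U - 1\<close> to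
  \<open>(1 - T) * (U - 1) * v\<close>, which raises the exponent of \<open>1 - T\<close> by
  one.\<close>

lemma \<delta>_compose:
  assumes "\<delta> 1 * v = 1"
  shows "\<delta> k oo (U * v) = \<delta> (Suc k) * v"
proof -
  have v: "(1 - T) * ((U - 1) * v) = U * v - 1"
    using assms by (simp add: \<delta>_altdef algebra_simps)
  have "\<delta> k oo (U * v) = U * v - (1 - T) ^ k * (U * v - 1)"
    by (simp add: \<delta>_altdef fps_compose_sub_distrib fps_compose_mult_distrib
        fps_compose_power[symmetric] U_nth_0)
  also have "\<dots> = \<delta> (Suc k) * v"
    by (simp add: \<delta>_altdef v[symmetric] algebra_simps)
  finally show ?thesis .
qed

text \<open>The mechanism is that of \<open>\<delta>_compose\<close>. The closed form of
  \<open>\<gamma>\<close> does not extend to \<open>k = 0\<close>, hence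
  \<open>k \<ge> 1\<close>.\<close>

lemma \<gamma>_compose:
  assumes "\<delta> 1 * v = 1" "k \<ge> 1"
  shows "\<gamma> k oo (U * v) = \<gamma> (Suc k) * v"
proof -
  obtain j where k: "k = Suc j" using assms(2) by (cases k) auto
  have v: "(1 - T) * ((U - 1) * v) = U * v - 1"
    using assms by (simp add: \<delta>_altdef algebra_simps)
  have "\<gamma> k oo (U * v) = U * v - (1 - Z * T) * (1 - T) ^ j * (U * v - 1)"
    by (simp add: \<gamma>_def k fps_compose_sub_distrib fps_compose_mult_distrib
        fps_compose_power[symmetric] U_nth_0)
  also have "\<dots> = \<gamma> (Suc k) * v"
    by (simp add: \<gamma>_def k v[symmetric] algebra_simps)
  finally show ?thesis .
qed

lemma \<delta>_1_dvd_1: "\<delta> 1 dvd 1" and \<gamma>_1_dvd_1: "\<gamma> 1 dvd 1"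
proof -
  have "1 / (\<gamma> 1 * \<delta> 1) * (\<gamma> 1 * \<delta> 1) = 1"
    \<comment> \<open>For \<open>k = p = 1\<close> the denominator is
      \<open>\<gamma> 1 * \<delta> 1\<close>, because \<open>\<delta> 0 = 1\<close>.\<close>
    using divide_denominator_cancel[of 1 1 1] by (simp add: \<delta>_def[of 0])
  then have "\<gamma> 1 * \<delta> 1 dvd 1" by (metis dvd_triv_right)
  then show "\<delta> 1 dvd 1" "\<gamma> 1 dvd 1"
    by (blast intro: dvd_mult_left dvd_mult_right)+
qed

lemma G_functional_equation:
  assumes r: "r \<ge> 1" and v: "\<delta> 1 * v = 1"
  shows "\<gamma> 1 * G p r 1 = U * T ^ r * Z ^ r * (v ^ p - 1) + U * v ^ p * (G p r 1 oo (U * v))"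
proof -
  define g :: "rat series_utz" where "g = G p r 1"
  define h where "h = fps_layered (\<lambda>a. layer p r a v)"
  define \<phi> where "\<phi> = g oo (U * v)"
  \<comment> \<open>The choice of \<open>v\<close> makes the terms with \<open>h\<close> cancel.\<close>
  have kernel: "v - 1 = T * v - T * U * v"
    using v by (simp add: \<delta>_altdef algebra_simps)
  \<comment> \<open>The right-hand side is the coefficient of \<open>T * g\<close> once the terms
    with \<open>h\<close> have cancelled.\<close>
  have \<gamma>v: "\<gamma> 1 * v = 1 - (Z - 1) * (v - 1)"
  proof -
    have "\<gamma> 1 * v = v - Z * (T * v - T * U * v)"
      by (simp add: \<gamma>_def algebra_simps)
    then show ?thesis unfolding kernel[symmetric] by (simp add: algebra_simps)
  qed
  have "(T * v - T * U * v) * h = U * T ^ Suc r * Z ^ r * (v ^ Suc p - v)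
      + T * (v * h - g + (Z - 1) * (v - 1) * g) + T * U * (v ^ Suc p * \<phi> - v * h)"
    using kernel_equation[OF r, of v p] unfolding kernel[symmetric] g_def h_def \<phi>_def .
  then have "T * g * (1 - (Z - 1) * (v - 1))
      = (T * v) * (U * T ^ r * Z ^ r * (v ^ p - 1) + U * v ^ p * \<phi>)"
    by (simp add: algebra_simps)
  then have "(T * v) * (\<gamma> 1 * g)
      = (T * v) * (U * T ^ r * Z ^ r * (v ^ p - 1) + U * v ^ p * \<phi>)"
    unfolding \<gamma>v[symmetric] by (simp add: mult_ac)
  \<comment> \<open>\<open>T\<close> is not a unit, so \<open>T * v\<close> is cancelled in an
    integral domain instead of being inverted.\<close>
  moreover have "T * v \<noteq> 0" using v by (auto simp: T_def)
  ultimately show ?thesis unfolding g_def \<phi>_def by (metis mult_left_cancel)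
qed

section \<open>Iterating the functional equation\<close>

lemma nth_eq_0_if_U_power_dvd:
  assumes "U ^ n dvd f" "k < n"
  shows "fps_nth f k = 0"
  using assms by (auto simp: U_def fps_X_power_mult_nth)

theorem theorem2p2:
  fixes p r :: nat
  assumes "p \<ge> 1" and "r \<ge> 1"
  shows "(\<lambda>j. let k = Suc j in
            T ^ r * Z ^ r * U ^ k * (\<delta> (k - 1) ^ p - \<delta> k ^ p)
              / ((\<Prod>i=1..k. \<gamma> i) * \<delta> (k - 1) ^ p * \<delta> k ^ p))
         sums G p r 1"
proof -
  define N where "N k = T ^ r * Z ^ r * U ^ k * (\<delta> (k - 1) ^ p - \<delta> k ^ p)" for k
  define D where "D k = (\<Prod>i=1..k. \<gamma> i) * \<delta> (k - 1) ^ p * \<delta> k ^ p" for k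
  define F where "F j = N (Suc j) / D (Suc j)" for j
  define g :: "rat series_utz" where "g = G p r 1"
  \<comment> \<open>In product form the summands can be carried through the substitution without
    composing quotients.\<close>
  have FD: "F j * D (Suc j) = N (Suc j)" for j
    unfolding F_def N_def D_def by (rule divide_denominator_cancel)
  have D_nz: "D k \<noteq> 0" for k
  proof
    assume "D k = 0"
    moreover have "1 / D k * D k = 1"
      unfolding D_def by (rule divide_denominator_cancel)
    ultimately show False by simp
  qed
  obtain v where v: "\<delta> 1 * v = 1" using \<delta>_1_dvd_1 by (metis dvdE)
  obtain c where c: "\<gamma> 1 * c = 1" using \<gamma>_1_dvd_1 by (metis dvdE)
  define \<phi> where "\<phi> f = f oo (U * v)" for f :: "rat series_utz"
  have \<phi>_mult: "\<phi> (x * y) = \<phi> x * \<phi> y" for x y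
    by (simp add: \<phi>_def fps_compose_mult_distrib U_nth_0)
  have \<phi>_power: "\<phi> (x ^ n) = \<phi> x ^ n" for x n
    by (simp add: \<phi>_def fps_compose_power U_nth_0)
  have vp: "\<delta> 1 ^ p * v ^ p = 1"
    using v by (simp flip: power_mult_distrib)
  \<comment> \<open>The inhomogeneous term of the functional equation, divided by
    \<open>\<gamma> 1\<close>, is the first summand, since \<open>\<delta> 0 = 1\<close> and
    \<open>v ^ p\<close> inverts \<open>\<delta> 1 ^ p\<close>.\<close>
  have g_eq: "g = F 0 + U * c * v ^ p * \<phi> g"
  proof -
    have "\<gamma> 1 * F 0 * \<delta> 1 ^ p = U * T ^ r * Z ^ r * (1 - \<delta> 1 ^ p)"
      using FD[of 0] by (simp add: D_def N_def \<delta>_def[of 0] mult_ac)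
    then have "\<gamma> 1 * F 0 * (\<delta> 1 ^ p * v ^ p)
        = U * T ^ r * Z ^ r * (v ^ p - \<delta> 1 ^ p * v ^ p)"
      by (simp add: left_diff_distrib mult.assoc[symmetric])
    then have "\<gamma> 1 * F 0 = U * T ^ r * Z ^ r * (v ^ p - 1)"
      by (simp only: vp mult_1_right)
    then have "\<gamma> 1 * g = \<gamma> 1 * F 0 + U * v ^ p * \<phi> g"
      using G_functional_equation[OF \<open>r \<ge> 1\<close> v, of p] by (simp add: g_def \<phi>_def)
    then have "(\<gamma> 1 * c) * g = (\<gamma> 1 * c) * F 0 + U * c * v ^ p * \<phi> g"
      by (metis (no_types, opaque_lifting) distrib_left mult.assoc mult.commute)
    then show ?thesis by (simp only: c mult_1_left)
  qed
  \<comment> \<open>The same operator takes each summand to the next: \<open>\<phi>\<close> raises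
    the indices of \<open>\<delta>\<close> and \<open>\<gamma>\<close> by one, and \<open>c\<close>
    supplies the missing factor 1 / \<open>\<gamma> 1\<close>.\<close>
  have F_Suc: "U * c * v ^ p * \<phi> (F j) = F (Suc j)" for j
  proof -
    let ?k = "Suc j"
    have \<phi>N: "\<phi> (N ?k) = T ^ r * Z ^ r * (U * v) ^ ?k * ((\<delta> ?k * v) ^ p - (\<delta> (Suc ?k) * v) ^ p)"
      by (simp add: N_def \<phi>_def fps_compose_mult_distrib fps_compose_sub_distrib
          fps_compose_power[symmetric] U_nth_0 \<delta>_compose[OF v] del: power_Suc)
    have "\<phi> (\<Prod>i=1..?k. \<gamma> i) = (\<Prod>i=1..?k. \<gamma> i oo (U * v))"
      unfolding \<phi>_def by (rule fps_compose_prod_distrib) (simp add: U_nth_0)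
    also have "\<dots> = (\<Prod>i=1..?k. \<gamma> (Suc i) * v)"
      by (rule prod.cong) (simp_all add: \<gamma>_compose[OF v])
    also have "\<dots> = (\<Prod>i=1..?k. \<gamma> (Suc i)) * v ^ ?k"
      by (simp add: prod.distrib del: prod.cl_ivl_Suc power_Suc)
    finally have \<phi>\<gamma>: "\<phi> (\<Prod>i=1..?k. \<gamma> i) = (\<Prod>i=1..?k. \<gamma> (Suc i)) * v ^ ?k" .
    have \<phi>D: "\<phi> (D ?k) = (\<Prod>i=1..?k. \<gamma> (Suc i)) * v ^ ?k * (\<delta> ?k * v) ^ p * (\<delta> (Suc ?k) * v) ^ p"
      unfolding D_def \<phi>_mult \<phi>_power \<phi>\<gamma> by (simp only: \<phi>_def \<delta>_compose[OF v] diff_Suc_1)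
    have "(\<Prod>i=1..Suc ?k. \<gamma> i) = \<gamma> 1 * (\<Prod>i=1..?k. \<gamma> (Suc i))"
      by (subst prod.atLeast_Suc_atMost)
        (simp_all add: prod.shift_bounds_cl_Suc_ivl del: prod.cl_ivl_Suc)
    \<comment> \<open>Powers of \<open>v\<close> balance: the denominator collects
      \<open>v ^ ?k\<close> and twice \<open>v ^ p\<close>; the numerator gets \<open>v ^ ?k\<close>
      and one \<open>v ^ p\<close> from \<open>\<phi>N\<close>, and the other \<open>v ^ p\<close>
      from the prefactor.\<close>
    then have D: "D (Suc ?k) * (v ^ ?k * v ^ p * v ^ p) = \<gamma> 1 * \<phi> (D ?k)"
      unfolding \<phi>D D_def[of "Suc ?k"]
      by (simp add: power_mult_distrib mult_ac del: power_Suc prod.cl_ivl_Suc)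
    have "U * c * v ^ p * \<phi> (F j) * (D (Suc ?k) * (v ^ ?k * v ^ p * v ^ p))
        = (\<gamma> 1 * c) * (U * v ^ p * \<phi> (F j * D ?k))"
      unfolding D \<phi>_mult by (simp add: mult_ac)
    also have "\<dots> = U * v ^ p * \<phi> (N ?k)"
      by (simp only: c FD mult_1_left)
    also have "\<dots> = N (Suc ?k) * (v ^ ?k * v ^ p * v ^ p)"
      unfolding \<phi>N N_def[of "Suc ?k"] by (simp add: power_mult_distrib algebra_simps)
    also have "\<dots> = F (Suc j) * (D (Suc ?k) * (v ^ ?k * v ^ p * v ^ p))"
      by (simp add: FD mult.assoc[symmetric])
    finally have "U * c * v ^ p * \<phi> (F j) * (D (Suc ?k) * (v ^ ?k * v ^ p * v ^ p))
      = F (Suc j) * (D (Suc ?k) * (v ^ ?k * v ^ p * v ^ p))" .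
    moreover have "D (Suc ?k) * (v ^ ?k * v ^ p * v ^ p) \<noteq> 0"
      using v D_nz by auto
    ultimately show ?thesis by (metis mult_right_cancel)
  qed
  \<comment> \<open>By \<open>g_eq\<close> and \<open>F_Suc\<close>, the next remainder is
    \<open>U * c * v ^ p\<close> times \<open>\<phi>\<close> of the current one.
    \<open>\<phi>\<close> preserves divisibility by \<open>U ^ n\<close>, and the prefactor adds one
    more \<open>U\<close>.\<close>
  have rem: "U ^ n dvd g - (\<Sum>j<n. F j)" for n
  proof (induction n)
    case (Suc n)
    then obtain R where R: "g - (\<Sum>j<n. F j) = U ^ n * R" by (rule dvdE)
    have "(\<Sum>j<Suc n. F j) = F 0 + U * c * v ^ p * \<phi> (\<Sum>j<n. F j)"
      by (simp add: sum.lessThan_Suc_shift \<phi>_def fps_compose_sum_distrib sum_distrib_left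
          flip: F_Suc del: sum.lessThan_Suc)
    then have "g - (\<Sum>j<Suc n. F j) = U * c * v ^ p * (\<phi> g - \<phi> (\<Sum>j<n. F j))"
      by (subst g_eq) (simp add: algebra_simps)
    also have "\<phi> g - \<phi> (\<Sum>j<n. F j) = \<phi> (U ^ n * R)"
      by (simp add: \<phi>_def R flip: fps_compose_sub_distrib)
    also have "\<phi> (U ^ n * R) = (U * v) ^ n * \<phi> R"
      by (simp add: \<phi>_mult \<phi>_power) (simp add: \<phi>_def U_nth_0)
    finally have "g - (\<Sum>j<Suc n. F j) = U ^ Suc n * (c * v ^ p * v ^ n * \<phi> R)"
      by (simp add: power_mult_distrib mult_ac)
    then show ?case by (rule dvdI)
  qed simp
  \<comment> \<open>Coefficient \<open>k\<close> of the partial sums is constant for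
    \<open>n > k\<close>, which is convergence in the \<open>U\<close>-adic metric.\<close>
  have "(\<lambda>n. \<Sum>j<n. F j) \<longlonglongrightarrow> g"
  proof (rule tendsto_fpsI)
    fix k
    have "fps_nth (\<Sum>j<n. F j) k = fps_nth g k" if "n > k" for n
      using nth_eq_0_if_U_power_dvd[OF rem that] by simp
    then show "\<forall>\<^sub>F n in sequentially. fps_nth (\<Sum>j<n. F j) k = fps_nth g k"
      using eventually_gt_at_top by (rule eventually_mono[rotated])
  qed
  then show ?thesis
    by (simp add: sums_def F_def N_def D_def g_def Let_def)
qed

end
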